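(* For any $\varepsilon>0$ there exists a constant $C_\varepsilon$ depending on $\varepsilon$ only, such that for any positive integers $n,m,D$ with $m>n$, $$\Big|\mathbb P\{D\mid B_nB_m\}-\frac{1}{D\,2^{m-n}}\sum_{k=0}^{m-n}\binom{m-n}{k}\varrho_k(D)\Big|\le C_\varepsilon\Big(\frac{D^{1+\varepsilon}}{n}\Big)^{1/2}.$$
   Context: $B_n=\sum_{k=1}^n\beta_k$ where $\beta_1,\beta_2,\dots$ are i.i.d. with $\mathbb P\{\beta_i=0\}=\mathbb P\{\beta_i=1\}=1/2$ (the same sequence for all $n$, so $B_m-B_n$ is independent of $B_n$ when $m>n$). For integers $k\ge0$, $D\ge1$, $\varrho_k(D)=\#\{1\le y\le D:\ D\mid y^2+ky\}$. Every positive integer divides $0$. *)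

theory Defs
  imports "HOL-Probability.Probability"
begin

text \<open>Only the values \<open>\<beta> i\<close> with \<open>i \<ge> 1\<close> are constrained; measurability of the
  variables is part of the library notion \<open>indep_vars\<close>.\<close>

definition iid_fair_bits :: "'a measure \<Rightarrow> (nat \<Rightarrow> 'a \<Rightarrow> nat) \<Rightarrow> bool" where
  "iid_fair_bits M \<beta> \<longleftrightarrow>
     prob_space M \<and>
     prob_space.indep_vars M (\<lambda>_. count_space UNIV) \<beta> {1..} \<and>
     (\<forall>i\<ge>1. measure M {\<omega> \<in> space M. \<beta> i \<omega> = 0} = 1 / 2 \<and>
             measure M {\<omega> \<in> space M. \<beta> i \<omega> = 1} = 1 / 2)"

definition bernoulli_sum :: "(nat \<Rightarrow> 'a \<Rightarrow> nat) \<Rightarrow> nat \<Rightarrow> 'a \<Rightarrow> nat" where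
  "bernoulli_sum \<beta> n \<omega> = (\<Sum>k = 1..n. \<beta> k \<omega>)"

definition rho :: "nat \<Rightarrow> nat \<Rightarrow> nat" where
  "rho k D = card {y \<in> {1..D}. D dvd y\<^sup>2 + k * y}"

end

theory Submission
  imports Defs
begin

text \<open>Condition on \<open>B\<^sub>m - B\<^sub>n = k\<close>, which is independent of \<open>B\<^sub>n\<close>; the event becomes that
  \<open>B\<^sub>n\<close> lies in one of \<open>\<rho>\<^sub>k(D)\<close> residue classes modulo \<open>D\<close>. Since the binomial weights are
  unimodal, their total variation is at most twice the middle weight, so each residue class has
  probability \<open>1/D + O(n\<^sup>-\<^sup>1\<^sup>/\<^sup>2)\<close>. It remains to see that \<open>\<rho>\<^sub>k(D) \<le> d(D) D\<^sup>1\<^sup>/\<^sup>2\<close>, with \<open>d(D)\<close> the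
  number of divisors, and that \<open>d(D) = O(D\<^sup>\<epsilon>)\<close>.\<close>

section \<open>Growth of the number of divisors\<close>

text \<open>Each divisor of a product factors into a divisor of \<open>a\<close> and a divisor of
  \<open>b\<close>, so multiplication maps the pairs onto the divisors of \<open>a * b\<close>;
  collisions only help an upper bound.\<close>

lemma card_divisors_mult_le:
  fixes a b :: nat
  assumes "a > 0" "b > 0"
  shows "card {d. d dvd a * b} \<le> card {d. d dvd a} * card {d. d dvd b}"
proof -
  have "{d. d dvd a * b} \<subseteq> (\<lambda>(x, y). x * y) ` ({d. d dvd a} \<times> {d. d dvd b})"
  proof
    fix d assume "d \<in> {d. d dvd a * b}"
    then obtain x y where "d = x * y" "x dvd a" "y dvd b"
      by (auto elim: dvd_productE)
    then show "d \<in> (\<lambda>(x, y). x * y) ` ({d. d dvd a} \<times> {d. d dvd b})"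
      by force
  qed
  moreover have "finite ({d. d dvd a} \<times> {d. d dvd b})"
    using assms by simp
  ultimately have "card {d. d dvd a * b} \<le> card ({d. d dvd a} \<times> {d. d dvd b})"
    by (rule surj_card_le[rotated])
  then show ?thesis
    by (simp add: card_cartesian_product)
qed

lemma card_divisors_prod_le:
  fixes f :: "'b \<Rightarrow> nat"
  assumes "finite A" "\<And>x. x \<in> A \<Longrightarrow> f x > 0"
  shows "card {d. d dvd prod f A} \<le> (\<Prod>x\<in>A. card {d. d dvd f x})"
  using assms
proof (induction A rule: finite_induct)
  case (insert x A)
  have "card {d. d dvd f x * prod f A} \<le> card {d. d dvd f x} * card {d. d dvd prod f A}"
    using insert.prems by (intro card_divisors_mult_le prod_pos) auto
  also have "\<dots> \<le> card {d. d dvd f x} * (\<Prod>x\<in>A. card {d. d dvd f x})"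
    using insert by (intro mult_left_mono) auto
  finally show ?case using insert.hyps by simp
qed simp

lemma card_divisors_prime_power:
  fixes p :: nat
  assumes "prime p"
  shows "card {d. d dvd p ^ a} = Suc a"
proof -
  have "{d. d dvd p ^ a} = (\<lambda>i. p ^ i) ` {..a}"
    by (auto simp: divides_primepow_nat[OF assms])
  moreover have "inj_on (\<lambda>i. p ^ i) {..a}"
    using prime_gt_1_nat[OF assms] by (auto intro!: inj_onI)
  ultimately show ?thesis by (simp add: card_image)
qed

text \<open>Large primes contribute at most \<open>p powr (a * \<epsilon>)\<close> each; each of the boundedly many
  small primes costs at most a constant factor.\<close>

lemma divisor_bound:
  fixes \<epsilon> :: real
  assumes "\<epsilon> > 0"
  obtains C where "C > 0" "\<And>n. n > 0 \<Longrightarrow> real (card {d. d dvd n}) \<le> C * real n powr \<epsilon>"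
proof -
  \<comment> \<open>The threshold makes \<open>p powr \<epsilon> \<ge> 2\<close> for every
    \<open>p \<ge> N\<close>, so that \<open>Suc a \<le> 2 ^ a\<close> suffices there without a
    constant.\<close>
  define N where "N = nat \<lceil>2 powr (1 / \<epsilon>)\<rceil>"
  define \<delta> where "\<delta> = 2 powr \<epsilon> - (1::real)"
  have \<delta>: "\<delta> > 0"
    using assms by (simp add: \<delta>_def)
  \<comment> \<open>\<open>K * (1 + a * \<delta>)\<close> expands to \<open>1 + a\<close> plus
    nonnegative terms, so Bernoulli's inequality for \<open>(1 + \<delta>) ^ a\<close> is strong
    enough for the small primes.\<close>
  define K where "K = 1 + 1 / \<delta>"
  have K: "K \<ge> 1"
    using \<delta> by (simp add: K_def)
  define c where "c p = (if p < N then K else 1)" for p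
  have prime_case: "real (Suc a) \<le> c p * real (p ^ a) powr \<epsilon>" if "prime p" for p a :: nat
  proof -
    have p2: "real p \<ge> 2" using prime_ge_2_nat[OF that] by simp
    have pow: "(real p ^ a) powr \<epsilon> = (real p powr \<epsilon>) ^ a"
      using p2 by (simp add: powr_power powr_realpow[symmetric] powr_powr mult.commute)
    show ?thesis
    proof (cases "p < N")
      case True
      have "1 + a * \<delta> \<le> (1 + \<delta>) ^ a"
        using \<delta> by (intro Bernoulli_inequality) auto
      also have "\<dots> \<le> (real p powr \<epsilon>) ^ a"
        unfolding \<delta>_def using p2 assms by (intro power_mono) (auto intro!: powr_mono2)
      finally have "K * (1 + a * \<delta>) \<le> K * (real p powr \<epsilon>) ^ a"
        using K by (intro mult_left_mono) auto
      moreover have "real (Suc a) \<le> K * (1 + a * \<delta>)"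
        using \<delta> by (simp add: K_def field_simps)
      ultimately show ?thesis using True by (simp add: c_def pow)
    next
      case False
      then have "2 powr (1 / \<epsilon>) \<le> real p"
        unfolding N_def by linarith
      then have "(2 powr (1 / \<epsilon>)) powr \<epsilon> \<le> real p powr \<epsilon>"
        using assms by (intro powr_mono2) auto
      then have "2 ^ a \<le> (real p powr \<epsilon>) ^ a"
        using assms by (intro power_mono) (auto simp: powr_powr)
      moreover have "real (Suc a) \<le> 2 ^ a"
        by (metis Suc_leI less_exp of_nat_le_iff of_nat_numeral of_nat_power)
      ultimately show ?thesis using False by (simp add: c_def pow)
    qed
  qed
  show thesis
  proof (rule that[of "K ^ N"])
    show "K ^ N > 0" using K by simp
    fix n :: nat assume n: "n > 0"
    let ?P = "prime_factors n"
    let ?q = "\<lambda>p. p ^ multiplicity p n"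
    have n_eq: "n = (\<Prod>p\<in>?P. ?q p)"
      using n by (rule Primes.prime_factorization_nat)
    have "real n = (\<Prod>p\<in>?P. real (?q p))"
      by (subst n_eq) (rule of_nat_prod)
    then have n_powr: "real n powr \<epsilon> = (\<Prod>p\<in>?P. real (?q p) powr \<epsilon>)"
      by (simp only: prod_powr_distrib of_nat_0_le_iff)
    have "real (card {d. d dvd n}) \<le> real (\<Prod>p\<in>?P. card {d. d dvd ?q p})"
      by (subst n_eq, subst of_nat_le_iff, rule card_divisors_prod_le)
         (auto simp: in_prime_factors_iff intro!: prime_gt_0_nat)
    also have "\<dots> = (\<Prod>p\<in>?P. real (Suc (multiplicity p n)))"
      by (auto simp: card_divisors_prime_power in_prime_factors_iff intro!: prod.cong)
    also have "\<dots> \<le> (\<Prod>p\<in>?P. c p * real (?q p) powr \<epsilon>)"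
      by (intro prod_mono conjI prime_case) auto
    also have "\<dots> = (\<Prod>p\<in>?P. c p) * real n powr \<epsilon>"
      by (simp only: n_powr prod.distrib)
    also have "\<dots> \<le> K ^ N * real n powr \<epsilon>"
    proof (rule mult_right_mono)
      \<comment> \<open>Only primes below \<open>N\<close> contribute a factor \<open>K\<close>, and
        there are at most \<open>N\<close> of them whatever \<open>n\<close> is.\<close>
      have "(\<Prod>p\<in>?P. c p) = (\<Prod>p\<in>?P \<inter> {..<N}. K)"
        unfolding c_def by (subst prod.If_cases) (simp_all add: lessThan_def)
      also have "\<dots> = K ^ card (?P \<inter> {..<N})" by simp
      also have "\<dots> \<le> K ^ N"
        using K card_mono[of "{..<N}" "?P \<inter> {..<N}"] by (intro power_increasing) auto
      finally show "(\<Prod>p\<in>?P. c p) \<le> K ^ N" .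
    qed simp
    finally show "real (card {d. d dvd n}) \<le> K ^ N * real n powr \<epsilon>" .
  qed
qed

section \<open>Roots of \<open>y\<^sup>2 + k * y\<close> modulo \<open>D\<close>\<close>

text \<open>Cut \<open>{1..a * q}\<close> into \<open>q\<close> blocks of \<open>a\<close>
  consecutive integers, indexed by \<open>(y - 1) div a\<close>. Two solutions differ by a multiple
  of \<open>a\<close>, so no block contains two.\<close>

lemma card_multiples_shift_le:
  fixes a q k :: nat
  assumes "a > 0"
  shows "card {y \<in> {1..a * q}. a dvd y + k} \<le> q"
proof -
  let ?A = "{y \<in> {1..a * q}. a dvd y + k}"
  have "inj_on (\<lambda>y. (y - 1) div a) ?A"
  proof (rule inj_onI)
    fix x y assume x: "x \<in> ?A" and y: "y \<in> ?A" and eq: "(x - 1) div a = (y - 1) div a"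
    \<comment> \<open>Subtraction truncates, so both orders are recorded: at least one difference is
      0, and the other is the true distance.\<close>
    have "a dvd x - y" "a dvd y - x"
      using dvd_diff_nat[of a "x + k" "y + k"] dvd_diff_nat[of a "y + k" "x + k"] x y by simp_all
    then have "a dvd (x - 1) - (y - 1)" "a dvd (y - 1) - (x - 1)"
      using x y by simp_all
    then have "(x - 1) mod a = (y - 1) mod a"
      by (metis linear mod_eq_dvd_iff_nat)
    with eq have "x - 1 = y - 1"
      by (metis div_mult_mod_eq)
    then show "x = y" using x y by auto
  qed
  moreover have "(\<lambda>y. (y - 1) div a) ` ?A \<subseteq> {..<q}"
    using assms by (auto simp: div_less_iff_less_mult mult.commute)
  ultimately have "card ?A \<le> card {..<q}"
    by (rule card_inj_on_le) simp
  then show ?thesis by simp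
qed

text \<open>If \<open>d = gcd y D\<close>, then \<open>D dvd y * (y + k)\<close> forces \<open>D div d dvd y + k\<close>. The two
  divisibilities leave at most \<open>D div d\<close> resp. \<open>d\<close> values of \<open>y\<close>.\<close>

lemma rho_le_divisors_sqrt:
  assumes "D > 0"
  shows "real (rho k D) \<le> real (card {d. d dvd D}) * sqrt (real D)"
proof -
  let ?Y = "\<lambda>d. {y \<in> {1..D}. d dvd y \<and> D div d dvd y + k}"
  have "{y \<in> {1..D}. D dvd y\<^sup>2 + k * y} \<subseteq> (\<Union>d\<in>{d. d dvd D}. ?Y d)"
  proof
    fix y assume y: "y \<in> {y \<in> {1..D}. D dvd y\<^sup>2 + k * y}"
    then have "D dvd y * (y + k)"
      by (simp add: power2_eq_square algebra_simps)
    \<comment> \<open>Any factorisation of \<open>D\<close> along the product will do;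
      \<open>a\<close> serves as the index \<open>d\<close>.\<close>
    then obtain a b where ab: "D = a * b" "a dvd y" "b dvd y + k"
      by (rule dvd_productE)
    then show "y \<in> (\<Union>d\<in>{d. d dvd D}. ?Y d)"
      using y assms by (intro UN_I[of a]) auto
  qed
  then have "rho k D \<le> card (\<Union>d\<in>{d. d dvd D}. ?Y d)"
    unfolding rho_def using assms by (intro card_mono) auto
  also have "\<dots> \<le> (\<Sum>d\<in>{d. d dvd D}. card (?Y d))"
    using assms by (intro card_UN_le) auto
  finally have "real (rho k D) \<le> (\<Sum>d\<in>{d. d dvd D}. real (card (?Y d)))"
    unfolding of_nat_sum[symmetric] of_nat_le_iff .
  also have "\<dots> \<le> (\<Sum>d\<in>{d. d dvd D}. sqrt (real D))"
  proof (rule sum_mono)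
    fix d assume "d \<in> {d. d dvd D}"
    then obtain e where D: "D = d * e" by auto
    with assms have pos: "d > 0" "e > 0" by auto
    have "card (?Y d) \<le> card {y \<in> {1..d * e}. d dvd y + 0}"
      by (intro card_mono) (auto simp: D)
    then have 1: "card (?Y d) \<le> e"
      using card_multiples_shift_le[OF pos(1)] order_trans by blast
    have "card (?Y d) \<le> card {y \<in> {1..e * d}. e dvd y + k}"
      using pos by (intro card_mono) (auto simp: D)
    then have 2: "card (?Y d) \<le> d"
      using card_multiples_shift_le[OF pos(2)] order_trans by blast
    \<comment> \<open>The count is at most \<open>d\<close> and at most \<open>e\<close>, so its
      square is at most \<open>d * e = D\<close>.\<close>
    have "(real (card (?Y d)))\<^sup>2 \<le> real D"
      unfolding power2_eq_square D of_nat_mult using 1 2 D by (intro mult_mono) auto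
    then show "real (card (?Y d)) \<le> sqrt (real D)"
      by (rule real_le_rsqrt)
  qed
  finally show ?thesis by simp
qed

text \<open>Both \<open>D\<close> and 0 are roots, so one may replace the other. Remainders starting
  at 0 fit the progressions \<open>r + i * D\<close> used later.\<close>

lemma rho_eq_card_lessThan:
  assumes "D > 0"
  shows "rho k D = card {y \<in> {..<D}. D dvd y\<^sup>2 + k * y}"
proof -
  have "rho k D = (\<Sum>y\<in>{1..D}. of_bool (D dvd y\<^sup>2 + k * y))"
    by (simp add: rho_def Int_def)
  also have "\<dots> = (\<Sum>y\<in>insert D {1..<D}. of_bool (D dvd y\<^sup>2 + k * y))"
    using assms by (intro sum.cong) auto
  also have "\<dots> = (\<Sum>y\<in>insert 0 {1..<D}. of_bool (D dvd y\<^sup>2 + k * y))"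
    by (simp add: power2_eq_square)
  also have "\<dots> = (\<Sum>y<D. of_bool (D dvd y\<^sup>2 + k * y))"
    using assms by (intro sum.cong) auto
  also have "\<dots> = card {y \<in> {..<D}. D dvd y\<^sup>2 + k * y}"
    by (simp add: Int_def)
  finally show ?thesis .
qed

section \<open>Total variation and sums over residue classes\<close>

lemma sum_blocks:
  fixes f :: "nat \<Rightarrow> 'b::comm_monoid_add"
  shows "(\<Sum>j<N * D. f j) = (\<Sum>r<D. \<Sum>i<N. f (r + i * D))"
proof -
  have "(\<Sum>j<N * D. f j) = (\<Sum>i<N. \<Sum>j=i * D..<i * D + D. f j)"
    by (rule sum.nat_group[symmetric])
  also have "\<dots> = (\<Sum>i<N. \<Sum>r<D. f (r + i * D))"
  proof (rule sum.cong[OF refl])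
    fix i
    show "(\<Sum>j=i * D..<i * D + D. f j) = (\<Sum>r<D. f (r + i * D))"
      using sum.shift_bounds_nat_ivl[of f 0 "i * D" D] by (simp add: atLeast0LessThan add.commute)
  qed
  also have "\<dots> = (\<Sum>r<D. \<Sum>i<N. f (r + i * D))"
    by (rule sum.swap)
  finally show ?thesis .
qed

text \<open>For \<open>r \<le> s < D\<close> the intervals from \<open>r + i * D\<close> to \<open>s + i * D\<close> are disjoint, so the
  difference is controlled by the total variation of \<open>f\<close>.\<close>

lemma progression_sums_diff_le:
  fixes f :: "nat \<Rightarrow> real"
  assumes "r < D" "s < D"
  shows "\<bar>(\<Sum>i<N. f (r + i * D)) - (\<Sum>i<N. f (s + i * D))\<bar> \<le> (\<Sum>j<N * D. \<bar>f (Suc j) - f j\<bar>)"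
  using assms
proof (induction r s rule: linorder_wlog)
  case (le r s)
  have "\<bar>(\<Sum>i<N. f (r + i * D)) - (\<Sum>i<N. f (s + i * D))\<bar>
      \<le> (\<Sum>i<N. \<bar>f (s + i * D) - f (r + i * D)\<bar>)"
    by (subst abs_minus_commute, subst sum_subtractf[symmetric], rule sum_abs)
  also have "\<dots> \<le> (\<Sum>i<N. \<Sum>j=i * D..<i * D + D. \<bar>f (Suc j) - f j\<bar>)"
  proof (rule sum_mono)
    fix i
    have "f (s + i * D) - f (r + i * D) = (\<Sum>j=r + i * D..<s + i * D. f (Suc j) - f j)"
      using le by (subst sum_Suc_diff') auto
    also have "\<bar>\<dots>\<bar> \<le> (\<Sum>j=r + i * D..<s + i * D. \<bar>f (Suc j) - f j\<bar>)"
      by (rule sum_abs)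
    also have "\<dots> \<le> (\<Sum>j=i * D..<i * D + D. \<bar>f (Suc j) - f j\<bar>)"
      using le by (intro sum_mono2) auto
    finally show "\<bar>f (s + i * D) - f (r + i * D)\<bar> \<le> \<dots>" .
  qed
  also have "\<dots> = (\<Sum>j<N * D. \<bar>f (Suc j) - f j\<bar>)"
    by (rule sum.nat_group)
  finally show ?case .
next
  case (sym r s)
  then show ?case by (simp add: abs_minus_commute)
qed

text \<open>\<open>?T / real D\<close> is the mean of the \<open>D\<close> class sums. The deviation
  of one class sum from the mean is the average of its differences from all of them, each bounded by
  the variation.\<close>

lemma progression_sum_equidistributed:
  fixes f :: "nat \<Rightarrow> real"
  assumes "r < D"
  shows "\<bar>(\<Sum>i<N. f (r + i * D)) - (\<Sum>j<N * D. f j) / real D\<bar> \<le> (\<Sum>j<N * D. \<bar>f (Suc j) - f j\<bar>)"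
    (is "\<bar>?S r - ?T / _\<bar> \<le> ?V")
proof -
  have "\<bar>real D * ?S r - ?T\<bar> = \<bar>\<Sum>s<D. ?S r - ?S s\<bar>"
    by (simp add: sum_blocks sum_subtractf)
  also have "\<dots> \<le> (\<Sum>s<D. \<bar>?S r - ?S s\<bar>)"
    by (rule sum_abs)
  also have "\<dots> \<le> (\<Sum>s<D. ?V)"
    using assms by (intro sum_mono progression_sums_diff_le) auto
  finally have "\<bar>real D * (?S r - ?T / real D)\<bar> \<le> real D * ?V"
    using assms by (simp add: right_diff_distrib)
  then show ?thesis
    using assms by (simp add: abs_mult)
qed

text \<open>The increments telescope separately on the two sides of the peak \<open>h\<close>,
  giving \<open>f h - f 0\<close> and \<open>f h - f (h + L)\<close>.\<close>

lemma unimodal_variation_le: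
  fixes f :: "nat \<Rightarrow> real"
  assumes "\<And>j. f j \<ge> 0" "\<And>j. j < h \<Longrightarrow> f j \<le> f (Suc j)" "\<And>j. j \<ge> h \<Longrightarrow> f (Suc j) \<le> f j"
  shows "(\<Sum>j<L. \<bar>f (Suc j) - f j\<bar>) \<le> 2 * f h"
proof -
  \<comment> \<open>Lengthening the range to \<open>h + L\<close> places the peak inside it even
    when \<open>L < h\<close>.\<close>
  have "(\<Sum>j<L. \<bar>f (Suc j) - f j\<bar>) \<le> (\<Sum>j<h + L. \<bar>f (Suc j) - f j\<bar>)"
    by (intro sum_mono2) auto
  also have "\<dots> = (\<Sum>j<h. \<bar>f (Suc j) - f j\<bar>) + (\<Sum>j=h..<h + L. \<bar>f (Suc j) - f j\<bar>)"
    using sum.atLeastLessThan_concat[of 0 h "h + L" "\<lambda>j. \<bar>f (Suc j) - f j\<bar>"]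
    by (simp add: atLeast0LessThan)
  also have "(\<Sum>j<h. \<bar>f (Suc j) - f j\<bar>) = (\<Sum>j<h. f (Suc j) - f j)"
    using assms(2) by (intro sum.cong) auto
  also have "\<dots> = f h - f 0"
    by (rule sum_lessThan_telescope)
  also have "(\<Sum>j=h..<h + L. \<bar>f (Suc j) - f j\<bar>) = (\<Sum>j=h..<h + L. - (f (Suc j) - f j))"
    using assms(3) by (intro sum.cong) auto
  also have "\<dots> = f h - f (h + L)"
    by (subst sum_negf, subst sum_Suc_diff') auto
  finally show ?thesis
    using assms(1)[of 0] assms(1)[of "h + L"] by linarith
qed

section \<open>Size of the middle binomial coefficient\<close>

text \<open>The squared ratio times \<open>2 * k + 1\<close> equals 1 at \<open>k = 0\<close> and
  does not increase with \<open>k\<close>. This form makes the induction close with elementary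
  algebra only.\<close>

lemma central_binomial_le: "real ((2 * k) choose k) / 4 ^ k \<le> 1 / sqrt (real (2 * k + 1))"
proof -
  have "(real ((2 * k) choose k) / 4 ^ k)\<^sup>2 * real (2 * k + 1) \<le> 1"
  proof (induction k)
    case (Suc k)
    have "real (Suc k) * real ((2 * Suc k) choose Suc k) = 2 * real (2 * k + 1) * real ((2 * k) choose k)"
    proof -
      have "Suc k * ((2 * Suc k) choose Suc k) = (2 * Suc k) * (Suc (2 * k) choose k)"
        using Suc_times_binomial[of k "Suc (2 * k)"] by simp
      then have "(2 * Suc k) choose Suc k = 2 * (Suc (2 * k) choose k)"
        by (metis mult.assoc mult.commute mult_cancel1 nat.distinct(1))
      moreover have "Suc (2 * k) choose k = Suc (2 * k) choose Suc k"
        using binomial_symmetric[of k "Suc (2 * k)"] by simp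
      moreover have "Suc k * (Suc (2 * k) choose Suc k) = Suc (2 * k) * ((2 * k) choose k)"
        by (rule Suc_times_binomial)
      ultimately have "Suc k * ((2 * Suc k) choose Suc k) = 2 * (2 * k + 1) * ((2 * k) choose k)"
        by (metis Suc_eq_plus1 mult.assoc mult.left_commute)
      then show ?thesis by (metis of_nat_mult of_nat_numeral)
    qed
    moreover have "x / (4 * u) = real (2 * k + 1) / real (2 * k + 2) * (y / u)"
      if "real (Suc k) * x = 2 * real (2 * k + 1) * y" for x y u :: real
      using that by (simp add: divide_simps) (simp add: algebra_simps)
    ultimately have step: "real ((2 * Suc k) choose Suc k) / 4 ^ Suc k
        = real (2 * k + 1) / real (2 * k + 2) * (real ((2 * k) choose k) / 4 ^ k)"
      unfolding power_Suc by blast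
    have "(real ((2 * Suc k) choose Suc k) / 4 ^ Suc k)\<^sup>2 * real (2 * Suc k + 1)
        = (real ((2 * k) choose k) / 4 ^ k)\<^sup>2 * real (2 * k + 1) *
          (real (2 * k + 1) * real (2 * k + 3) / (real (2 * k + 2))\<^sup>2)"
      unfolding step by (simp add: power_mult_distrib power_divide power2_eq_square ac_simps)
    also have "\<dots> \<le> 1 * 1"
    proof (rule mult_mono[OF Suc.IH])
      \<comment> \<open>The numerator is \<open>(2 * k + 2)\<^sup>2 - 1\<close>.\<close>
      show "real (2 * k + 1) * real (2 * k + 3) / (real (2 * k + 2))\<^sup>2 \<le> 1"
      proof (subst divide_le_eq_1_pos)
        show "(real (2 * k + 2))\<^sup>2 > 0"
          by (rule zero_less_power) simp
      qed (simp add: power2_eq_square algebra_simps)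
    qed auto
    finally show ?case by simp
  qed simp
  then have "(real ((2 * k) choose k) / 4 ^ k)\<^sup>2 \<le> (1 / sqrt (real (2 * k + 1)))\<^sup>2"
    by (subst power_divide, subst real_sqrt_pow2, simp, subst pos_le_divide_eq) simp_all
  then show ?thesis
    by (rule power2_le_imp_le) simp
qed

lemma middle_binomial_le:
  assumes "n > 0"
  shows "real (n choose (n div 2)) / 2 ^ n \<le> 1 / sqrt (real n)"
proof (cases "even n")
  case True
  then obtain k where n: "n = 2 * k" by auto
  have "real (n choose (n div 2)) / 2 ^ n \<le> 1 / sqrt (real (2 * k + 1))"
    using central_binomial_le[of k] by (simp add: n power_mult)
  also have "\<dots> \<le> 1 / sqrt (real n)"
    using assms by (intro divide_left_mono) (auto simp: n)
  finally show ?thesis .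
next
  case False
  then obtain k where n: "n = 2 * k + 1" by (auto elim: oddE)
  \<comment> \<open>Pascal's rule: the two middle coefficients of an odd row are equal and add up to
    the central coefficient of the next row. The factor 2 is absorbed by the power of 2, which
    reduces odd \<open>n\<close> to the central case.\<close>
  have "(2 * Suc k) choose Suc k = 2 * (n choose k)"
    using binomial_symmetric[of k "2 * k + 1"] by (simp add: n)
  then have "real (n choose (n div 2)) / 2 ^ n = real ((2 * Suc k) choose Suc k) / 4 ^ Suc k"
    by (simp add: n power_mult)
  also have "\<dots> \<le> 1 / sqrt (real (2 * Suc k + 1))"
    by (rule central_binomial_le)
  also have "\<dots> \<le> 1 / sqrt (real n)"
    using assms by (intro divide_left_mono) (auto simp: n)
  finally show ?thesis .
qed

section \<open>Binomial weights in residue classes\<close>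

text \<open>The weights have total mass 1 and peak at \<open>n div 2\<close>, so their variation is
  at most twice the middle weight; this is the source of the constant 2.\<close>

lemma binomial_progression_equidistributed:
  assumes "n > 0" "r < D"
  shows "\<bar>(\<Sum>i<Suc n. real (n choose (r + i * D)) / 2 ^ n) - 1 / real D\<bar> \<le> 2 / sqrt (real n)"
proof -
  let ?f = "\<lambda>j. real (n choose j) / 2 ^ n"
  \<comment> \<open>\<open>Suc n\<close> blocks of length \<open>D\<close> cover all of
    \<open>{..n}\<close>, so cutting off the progression there loses no mass.\<close>
  have "n < Suc n * D"
    using assms by (cases D) auto
  then have "(\<Sum>j<Suc n * D. n choose j) = (\<Sum>j\<le>n. n choose j)"
    by (intro sum.mono_neutral_right) auto
  then have total: "(\<Sum>j<Suc n * D. ?f j) = 1"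
    unfolding sum_divide_distrib[symmetric] of_nat_sum[symmetric] by (simp add: choose_row_sum)
  have "(\<Sum>j<Suc n * D. \<bar>?f (Suc j) - ?f j\<bar>) \<le> 2 * ?f (n div 2)"
  proof (rule unimodal_variation_le)
    fix j assume "j < n div 2"
    then show "?f j \<le> ?f (Suc j)"
      by (intro divide_right_mono of_nat_mono binomial_mono) auto
  next
    fix j assume "j \<ge> n div 2"
    then show "?f (Suc j) \<le> ?f j"
      by (cases "Suc j \<le> n") (auto intro!: divide_right_mono of_nat_mono binomial_antimono
          simp: not_le binomial_eq_0)
  qed auto
  also have "\<dots> \<le> 2 / sqrt (real n)"
    using middle_binomial_le[OF assms(1)] by simp
  finally show ?thesis
    using progression_sum_equidistributed[OF assms(2), of ?f "Suc n"] total by simp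
qed

text \<open>The divisibility depends only on \<open>j\<close> modulo \<open>D\<close>, so the sum
  runs over \<open>rho k D\<close> full residue classes, and the errors of the single classes add
  up.\<close>

lemma binomial_rho_approx:
  assumes "n > 0" "D > 0"
  shows "\<bar>(\<Sum>j\<in>{j. j \<le> n \<and> D dvd j\<^sup>2 + k * j}. real (n choose j) / 2 ^ n) - real (rho k D) / real D\<bar>
    \<le> real (rho k D) * (2 / sqrt (real n))"
proof -
  let ?f = "\<lambda>j. real (n choose j) / 2 ^ n"
  let ?R = "{r \<in> {..<D}. D dvd r\<^sup>2 + k * r}"
  have periodic: "D dvd (r + i * D)\<^sup>2 + k * (r + i * D) \<longleftrightarrow> D dvd r\<^sup>2 + k * r" for r i
  proof -
    have "(r + i * D)\<^sup>2 + k * (r + i * D) = (r\<^sup>2 + k * r) + D * (2 * i * r + i * i * D + k * i)"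
      by (simp add: power2_eq_square algebra_simps)
    then show ?thesis by (simp only: dvd_add_times_triv_right_iff dvd_add_left_iff dvd_triv_left)
  qed
  have "n < Suc n * D"
    using assms by (cases D) auto
  then have "(\<Sum>j\<in>{j. j \<le> n \<and> D dvd j\<^sup>2 + k * j}. ?f j)
      = (\<Sum>j<Suc n * D. if D dvd j\<^sup>2 + k * j then ?f j else 0)"
    by (intro sum.mono_neutral_cong_left) auto
  also have "\<dots> = (\<Sum>r<D. \<Sum>i<Suc n. if D dvd r\<^sup>2 + k * r then ?f (r + i * D) else 0)"
    by (subst sum_blocks) (simp only: periodic)
  also have "\<dots> = (\<Sum>r\<in>?R. \<Sum>i<Suc n. ?f (r + i * D))"
    by (intro sum.mono_neutral_cong_right) auto
  finally have diff: "(\<Sum>j\<in>{j. j \<le> n \<and> D dvd j\<^sup>2 + k * j}. ?f j) - real (rho k D) / real D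
      = (\<Sum>r\<in>?R. (\<Sum>i<Suc n. ?f (r + i * D)) - 1 / real D)"
    by (simp add: sum_subtractf rho_eq_card_lessThan[OF assms(2)])
  have "\<bar>\<Sum>r\<in>?R. (\<Sum>i<Suc n. ?f (r + i * D)) - 1 / real D\<bar>
      \<le> (\<Sum>r\<in>?R. \<bar>(\<Sum>i<Suc n. ?f (r + i * D)) - 1 / real D\<bar>)"
    by (rule sum_abs)
  also have "\<dots> \<le> (\<Sum>r\<in>?R. 2 / sqrt (real n))"
    by (rule sum_mono, rule binomial_progression_equidistributed[OF assms(1)]) simp
  also have "\<dots> = real (rho k D) * (2 / sqrt (real n))"
    by (simp add: rho_eq_card_lessThan[OF assms(2)])
  finally show ?thesis
    by (simp only: diff)
qed

section \<open>Distribution of sums of fair bits\<close>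

lemma measurable_sum_count_space:
  fixes f :: "'i \<Rightarrow> 'a \<Rightarrow> nat"
  assumes "\<And>i. i \<in> A \<Longrightarrow> f i \<in> measurable M (count_space UNIV)"
  shows "(\<lambda>x. \<Sum>i\<in>A. f i x) \<in> measurable M (count_space UNIV)"
  using assms unfolding measurable_cong_sets[OF refl sets_borel_eq_count_space, symmetric]
  by (rule borel_measurable_sum)

context
  fixes M :: "'a measure" and \<beta> :: "nat \<Rightarrow> 'a \<Rightarrow> nat"
  assumes iid: "iid_fair_bits M \<beta>"
begin

interpretation prob_space M
  using iid by (simp add: iid_fair_bits_def)

lemma bits_indep: "indep_vars (\<lambda>_. count_space UNIV) \<beta> {1..}"
  using iid by (simp add: iid_fair_bits_def)

lemma measurable_bit: "i \<ge> 1 \<Longrightarrow> \<beta> i \<in> measurable M (count_space UNIV)"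
  using bits_indep by (auto simp: indep_vars_def)

lemma measurable_bit_sum:
  assumes "A \<subseteq> {1..}"
  shows "(\<lambda>\<omega>. \<Sum>i\<in>A. \<beta> i \<omega>) \<in> measurable M (count_space UNIV)"
  using assms by (intro measurable_sum_count_space measurable_bit) auto

text \<open>Restrictions of an independent family to disjoint index sets are independent random
  vectors, and each sum is a measurable function of its own vector.\<close>

lemma bit_sums_indep:
  assumes "A \<inter> B = {}" "A \<subseteq> {1..}" "B \<subseteq> {1..}" "finite A" "finite B"
  shows "prob {\<omega> \<in> space M. (\<Sum>i\<in>A. \<beta> i \<omega>) = a \<and> (\<Sum>i\<in>B. \<beta> i \<omega>) = b}
    = prob {\<omega> \<in> space M. (\<Sum>i\<in>A. \<beta> i \<omega>) = a} * prob {\<omega> \<in> space M. (\<Sum>i\<in>B. \<beta> i \<omega>) = b}"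
proof -
  have meas: "(\<lambda>f. \<Sum>i\<in>I. f i :: nat) \<in> measurable (PiM I (\<lambda>_. count_space UNIV)) (count_space UNIV)"
    for I :: "nat set"
    by (intro measurable_sum_count_space[where f = "\<lambda>i f. f i"] measurable_component_singleton)
  have "indep_var (count_space UNIV) ((\<lambda>f. \<Sum>i\<in>A. f i) \<circ> (\<lambda>\<omega>. restrict (\<lambda>i. \<beta> i \<omega>) A))
      (count_space UNIV) ((\<lambda>f. \<Sum>i\<in>B. f i) \<circ> (\<lambda>\<omega>. restrict (\<lambda>i. \<beta> i \<omega>) B))"
    by (intro indep_var_compose[OF indep_var_restrict[OF bits_indep]] meas assms)
  from indep_varD[OF this, of "{a}" "{b}"] show ?thesis
    by (simp add: vimage_def Int_def conj_commute)
qed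

text \<open>The bits are natural-valued with only the masses at 0 and 1 prescribed. These add up to
  1, so other values are confined to a null set; event identities below therefore hold almost
  everywhere.\<close>

lemma AE_bit_le_1:
  assumes "i \<ge> 1"
  shows "AE \<omega> in M. \<beta> i \<omega> \<le> 1"
proof -
  note [measurable] = measurable_bit[OF assms]
  have "prob {\<omega> \<in> space M. \<beta> i \<omega> \<le> 1}
      = prob ({\<omega> \<in> space M. \<beta> i \<omega> = 0} \<union> {\<omega> \<in> space M. \<beta> i \<omega> = 1})"
    by (intro arg_cong[of _ _ prob]) auto
  also have "\<dots> = prob {\<omega> \<in> space M. \<beta> i \<omega> = 0} + prob {\<omega> \<in> space M. \<beta> i \<omega> = 1}"
    by (intro finite_measure_Union) auto
  also have "\<dots> = 1 / 2 + 1 / 2"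
    using iid assms by (auto simp: iid_fair_bits_def intro!: arg_cong2[of _ _ _ _ plus])
  finally show ?thesis
    by (simp add: prob_Collect_eq_1)
qed

lemma prob_bit_eq:
  assumes "i \<ge> 1"
  shows "prob {\<omega> \<in> space M. \<beta> i \<omega> = v} = (if v \<le> 1 then 1 / 2 else 0)"
proof -
  have "prob {\<omega> \<in> space M. \<beta> i \<omega> = v} = 0" if "v > 1"
    using AE_bit_le_1[OF assms] that by (intro prob_eq_0_AE) (auto elim!: eventually_mono)
  then show ?thesis
    using iid assms by (auto simp: iid_fair_bits_def le_Suc_eq)
qed

lemma AE_bit_sum_le:
  assumes "A \<subseteq> {1..}" "finite A"
  shows "AE \<omega> in M. (\<Sum>i\<in>A. \<beta> i \<omega>) \<le> card A"
proof -
  have "AE \<omega> in M. \<forall>i\<in>A. \<beta> i \<omega> \<le> 1"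
    using assms by (intro AE_finite_allI AE_bit_le_1) auto
  then show ?thesis
    by eventually_elim (use sum_bounded_above[of A _ "1 :: nat"] in fastforce)
qed

text \<open>Splitting on the value of one bit turns the induction step into Pascal's rule. General
  index sets cover both \<open>{1..n}\<close> and the increment \<open>{Suc n..m}\<close>.\<close>

lemma prob_bit_sum:
  assumes "finite A" "A \<subseteq> {1..}"
  shows "prob {\<omega> \<in> space M. (\<Sum>i\<in>A. \<beta> i \<omega>) = a} = real (card A choose a) / 2 ^ card A"
  using assms
proof (induction A arbitrary: a rule: finite_induct)
  case empty
  show ?case by (cases a) (auto simp: prob_space)
next
  case (insert x A)
  let ?S = "\<lambda>\<omega>. \<Sum>i\<in>A. \<beta> i \<omega>"
  have x: "x \<ge> 1" and A: "A \<subseteq> {1..}" using insert.prems by auto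
  note [measurable] = measurable_bit[OF x] measurable_bit_sum[OF A]
  have joint: "prob {\<omega> \<in> space M. \<beta> x \<omega> = u \<and> ?S \<omega> = v}
      = prob {\<omega> \<in> space M. \<beta> x \<omega> = u} * prob {\<omega> \<in> space M. ?S \<omega> = v}"
    for u v
    using bit_sums_indep[of "{x}" A u v] insert.hyps x A by simp
  \<comment> \<open>Writing \<open>Suc (?S \<omega>) = a\<close> rather than using
    \<open>a - 1\<close> makes the second event empty for \<open>a = 0\<close>.\<close>
  have "prob {\<omega> \<in> space M. (\<Sum>i\<in>insert x A. \<beta> i \<omega>) = a}
      = prob ({\<omega> \<in> space M. \<beta> x \<omega> = 0 \<and> ?S \<omega> = a} \<union>
              {\<omega> \<in> space M. \<beta> x \<omega> = 1 \<and> Suc (?S \<omega>) = a})"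
  proof (rule finite_measure_eq_AE)
    show "AE \<omega> in M. \<omega> \<in> {\<omega> \<in> space M. (\<Sum>i\<in>insert x A. \<beta> i \<omega>) = a} \<longleftrightarrow>
        \<omega> \<in> {\<omega> \<in> space M. \<beta> x \<omega> = 0 \<and> ?S \<omega> = a} \<union> {\<omega> \<in> space M. \<beta> x \<omega> = 1 \<and> Suc (?S \<omega>) = a}"
      using AE_bit_le_1[OF x] by eventually_elim (use insert.hyps in \<open>auto simp: le_Suc_eq\<close>)
    show "{\<omega> \<in> space M. (\<Sum>i\<in>insert x A. \<beta> i \<omega>) = a} \<in> events"
      using measurable_bit_sum[OF insert.prems] by simp
  qed simp
  also have "\<dots> = prob {\<omega> \<in> space M. \<beta> x \<omega> = 0 \<and> ?S \<omega> = a} +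
      prob {\<omega> \<in> space M. \<beta> x \<omega> = 1 \<and> Suc (?S \<omega>) = a}"
    by (intro finite_measure_Union) auto
  also have "\<dots> = real (card (insert x A) choose a) / 2 ^ card (insert x A)"
    using insert.hyps joint[of 0 a] joint[of 1 "a - 1"] insert.IH[OF A] prob_bit_eq[OF x]
    by (cases a) (auto simp: field_simps simp del: sum_eq_0_iff)
  finally show ?case .
qed

text \<open>With \<open>X\<close> the first sum and \<open>Y\<close> the increment, the product is
  \<open>X * (X + Y)\<close>, which is \<open>X\<^sup>2 + k * X\<close> on \<open>Y = k\<close>.
  Independence factors the joint probabilities.\<close>

lemma prob_dvd_bernoulli_sums:
  assumes "m > n"
  shows "prob {\<omega> \<in> space M. D dvd bernoulli_sum \<beta> n \<omega> * bernoulli_sum \<beta> m \<omega>}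
    = (\<Sum>k = 0..m - n. real ((m - n) choose k) / 2 ^ (m - n) *
        (\<Sum>j\<in>{j. j \<le> n \<and> D dvd j\<^sup>2 + k * j}. real (n choose j) / 2 ^ n))"
proof -
  define X where "X \<omega> = (\<Sum>i=1..n. \<beta> i \<omega>)" for \<omega>
  define Y where "Y \<omega> = (\<Sum>i=Suc n..m. \<beta> i \<omega>)" for \<omega>
  have X: "bernoulli_sum \<beta> n \<omega> = X \<omega>" for \<omega>
    by (simp add: bernoulli_sum_def X_def)
  have XY: "bernoulli_sum \<beta> m \<omega> = X \<omega> + Y \<omega>" for \<omega>
    using assms sum.ub_add_nat[of 1 n "\<lambda>i. \<beta> i \<omega>" "m - n"]
    by (simp add: bernoulli_sum_def X_def Y_def)
  have [measurable]: "X \<in> measurable M (count_space UNIV)" "Y \<in> measurable M (count_space UNIV)"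
    unfolding X_def[abs_def] Y_def[abs_def] by (intro measurable_bit_sum; auto)+
  define S where "S = (SIGMA k:{0..m - n}. {j. j \<le> n \<and> D dvd j\<^sup>2 + k * j})"
  have "AE \<omega> in M. X \<omega> \<le> n" "AE \<omega> in M. Y \<omega> \<le> m - n"
    unfolding X_def Y_def using AE_bit_sum_le[of "{1..n}"] AE_bit_sum_le[of "{Suc n..m}"] by auto
  \<comment> \<open>The almost sure bounds on \<open>X\<close> and \<open>Y\<close> permit a finite
    index set \<open>S\<close> of pairs (increment \<open>k\<close>, first sum
    \<open>j\<close>).\<close>
  then have "prob {\<omega> \<in> space M. D dvd bernoulli_sum \<beta> n \<omega> * bernoulli_sum \<beta> m \<omega>}
      = prob (\<Union>(k, j)\<in>S. {\<omega> \<in> space M. X \<omega> = j \<and> Y \<omega> = k})"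
  proof (intro finite_measure_eq_AE)
    assume "AE \<omega> in M. X \<omega> \<le> n" "AE \<omega> in M. Y \<omega> \<le> m - n"
    then show "AE \<omega> in M. \<omega> \<in> {\<omega> \<in> space M. D dvd bernoulli_sum \<beta> n \<omega> * bernoulli_sum \<beta> m \<omega>} \<longleftrightarrow>
        \<omega> \<in> (\<Union>(k, j)\<in>S. {\<omega> \<in> space M. X \<omega> = j \<and> Y \<omega> = k})"
      by eventually_elim (auto simp: X XY S_def power2_eq_square algebra_simps)
  qed (auto simp: X XY S_def)
  also have "\<dots> = (\<Sum>(k, j)\<in>S. prob {\<omega> \<in> space M. X \<omega> = j \<and> Y \<omega> = k})"
    by (subst finite_measure_finite_Union)
       (auto simp: S_def disjoint_family_on_def case_prod_beta)
  also have "\<dots> = (\<Sum>(k, j)\<in>S. real ((m - n) choose k) / 2 ^ (m - n) * (real (n choose j) / 2 ^ n))"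
  proof (intro sum.cong refl, clarify)
    fix k j
    have "prob {\<omega> \<in> space M. X \<omega> = j \<and> Y \<omega> = k} = prob {\<omega> \<in> space M. X \<omega> = j} * prob {\<omega> \<in> space M. Y \<omega> = k}"
      unfolding X_def Y_def by (rule bit_sums_indep) auto
    then show "prob {\<omega> \<in> space M. X \<omega> = j \<and> Y \<omega> = k}
        = real ((m - n) choose k) / 2 ^ (m - n) * (real (n choose j) / 2 ^ n)"
      using prob_bit_sum[of "{1..n}" j] prob_bit_sum[of "{Suc n..m}" k] by (simp add: X_def Y_def mult.commute)
  qed
  also have "\<dots> = (\<Sum>k = 0..m - n. real ((m - n) choose k) / 2 ^ (m - n) *
        (\<Sum>j\<in>{j. j \<le> n \<and> D dvd j\<^sup>2 + k * j}. real (n choose j) / 2 ^ n))"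
    unfolding S_def by (subst sum.Sigma[symmetric]) (auto simp: sum_distrib_left)
  finally show ?thesis .
qed

end

section \<open>Averaging over the increment\<close>

theorem theorem6p1:
  fixes \<epsilon> :: real
  assumes "\<epsilon> > 0"
  shows "\<exists>C::real. \<forall>(M :: 'a measure) (\<beta> :: nat \<Rightarrow> 'a \<Rightarrow> nat).
    iid_fair_bits M \<beta> \<longrightarrow>
    (\<forall>n m D :: nat. n > 0 \<longrightarrow> m > n \<longrightarrow> D > 0 \<longrightarrow>
      \<bar>measure M {\<omega> \<in> space M. D dvd bernoulli_sum \<beta> n \<omega> * bernoulli_sum \<beta> m \<omega>}
        - 1 / (real D * 2 ^ (m - n)) *
          (\<Sum>k = 0..m - n. real ((m - n) choose k) * real (rho k D))\<bar>
      \<le> C * (real D powr (1 + \<epsilon>) / real n) powr (1 / 2))"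
proof -
  \<comment> \<open>The exponent is halved because \<open>D powr (\<epsilon> / 2) * sqrt D\<close>
    is the square root of \<open>D powr (1 + \<epsilon>)\<close>. Here \<open>K\<close> is fixed
    before the probability space and \<open>n\<close>, \<open>m\<close>, \<open>D\<close>.\<close>
  obtain K where K: "K > 0"
    "\<And>D. D > 0 \<Longrightarrow> real (card {d. d dvd D}) \<le> K * real D powr (\<epsilon> / 2)"
    using divisor_bound[of "\<epsilon> / 2"] assms by auto
  show ?thesis
  proof (intro exI[of _ "2 * K"] allI impI)
    fix M :: "'a measure" and \<beta> :: "nat \<Rightarrow> 'a \<Rightarrow> nat" and n m D :: nat
    assume iid: "iid_fair_bits M \<beta>" and n: "n > 0" and m: "m > n" and D: "D > 0"
    define w where "w k = real ((m - n) choose k) / 2 ^ (m - n)" for k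
    define p where "p k = (\<Sum>j\<in>{j. j \<le> n \<and> D dvd j\<^sup>2 + k * j}. real (n choose j) / 2 ^ n)" for k
    define E where "E = 2 * K * (real D powr (1 + \<epsilon>) / real n) powr (1 / 2)"
    \<comment> \<open>The bound is uniform in \<open>k\<close>, so averaging with the weights
      \<open>w\<close>, which sum to 1, preserves it.\<close>
    have E: "\<bar>p k - real (rho k D) / real D\<bar> \<le> E" for k
    proof -
      have "real (rho k D) \<le> K * real D powr (\<epsilon> / 2) * sqrt (real D)"
        using rho_le_divisors_sqrt[OF D, of k] K(2)[OF D]
        by (meson mult_right_mono order_trans real_sqrt_ge_zero of_nat_0_le_iff)
      then have "real (rho k D) * (2 / sqrt (real n)) \<le> K * real D powr (\<epsilon> / 2) * sqrt (real D) * (2 / sqrt (real n))"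
        by (intro mult_right_mono) auto
      also have "\<dots> = E"
        using D n by (simp add: E_def powr_half_sqrt[symmetric] powr_divide powr_powr
            powr_add[symmetric] add_divide_distrib add.commute)
      finally show ?thesis
        using binomial_rho_approx[OF n D, of k] unfolding p_def by linarith
    qed
    have "(\<Sum>k=0..m - n. (m - n) choose k) = 2 ^ (m - n)"
      by (simp add: choose_row_sum atLeast0AtMost)
    then have w_sum: "(\<Sum>k=0..m - n. w k) = 1"
      unfolding w_def sum_divide_distrib[symmetric] of_nat_sum[symmetric] by simp
    \<comment> \<open>Exact probability and main term are averages with the same weights
      \<open>w\<close>, so their difference is an average of the conditional errors.\<close>
    have "measure M {\<omega> \<in> space M. D dvd bernoulli_sum \<beta> n \<omega> * bernoulli_sum \<beta> m \<omega>}
        - 1 / (real D * 2 ^ (m - n)) * (\<Sum>k = 0..m - n. real ((m - n) choose k) * real (rho k D))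
      = (\<Sum>k=0..m - n. w k * (p k - real (rho k D) / real D))"
      unfolding prob_dvd_bernoulli_sums[OF iid m]
      by (simp add: w_def p_def sum_subtractf right_diff_distrib sum_distrib_left mult.commute)
    also have "\<bar>\<dots>\<bar> \<le> (\<Sum>k=0..m - n. \<bar>w k * (p k - real (rho k D) / real D)\<bar>)"
      by (rule sum_abs)
    also have "\<dots> \<le> (\<Sum>k=0..m - n. w k * E)"
      unfolding abs_mult using E by (intro sum_mono mult_mono) (auto simp: w_def)
    also have "\<dots> = E"
      by (simp add: sum_distrib_right[symmetric] w_sum)
    finally show "\<bar>measure M {\<omega> \<in> space M. D dvd bernoulli_sum \<beta> n \<omega> * bernoulli_sum \<beta> m \<omega>}
        - 1 / (real D * 2 ^ (m - n)) * (\<Sum>k = 0..m - n. real ((m - n) choose k) * real (rho k D))\<bar>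
      \<le> 2 * K * (real D powr (1 + \<epsilon>) / real n) powr (1 / 2)"
      unfolding E_def .
  qed
qed

end
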